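(* Let $R$ be a commutative Armendariz ring, $\sigma$ an endomorphism of $R$, and $M_R$ a module satisfying the condition $(\mathcal{C}_{\sigma}^2)$. Then $M_R$ is Armendariz if and only if $R\oplus_{\sigma}M_R$ is Armendariz.
   Context: All rings are associative with identity and modules are right modules. $M_R$ satisfies the condition $(\mathcal{C}_{\sigma}^2)$ if for all $m\in M$ and $a\in R$, $m\sigma(a)a=0$ implies $m\sigma(a)=0$. For a commutative ring $R$, a module $M_R$ and an endomorphism $\sigma$ of $R$, the Nagata extension $R\oplus_{\sigma}M_R$ is the additive group $R\oplus M$ with the (possibly noncommutative) multiplication $(a,m)(b,n)=(ab,\,n\sigma(a)+mb)$ for $a,b\in R$, $m,n\in M$. A module $M$ over a ring $R$ is Armendariz if whenever $m=\sum_{i=0}^{n}m_ix^i\in M[x]$ and $f=\sum_{j=0}^{p}a_jx^j\in R[x]$ satisfy $mf=0$ (where $mf=\sum_{i,j}m_ia_jx^{i+j}$), then $m_ia_j=0$ for all $i,j$. A ring $T$ is Armendariz if the module $T_T$ is Armendariz. *)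

theory Defs
  imports "HOL-Algebra.UnivPoly"
begin

text \<open>
  The library's locale \<^locale>\<open>module\<close> covers only (left) modules over commutative rings, whereas
  a noncommutative ring has to be viewed here as a right module over itself. As in the library's
  record for modules, only the additive part of the underlying ring record is used.
\<close>

record ('a, 'b) rmodule = "'b ring" +
  rsmult :: "'b \<Rightarrow> 'a \<Rightarrow> 'b" (infixl \<open>\<triangleleft>\<index>\<close> 70)

locale right_module = R?: ring R + M?: abelian_group M
  for R :: "('a, 'c) ring_scheme" (structure) and M :: "('a, 'b, 'd) rmodule_scheme" (structure) +
  assumes rsmult_closed [simp, intro]:
      "\<lbrakk>x \<in> carrier M; a \<in> carrier R\<rbrakk> \<Longrightarrow> x \<triangleleft>\<^bsub>M\<^esub> a \<in> carrier M"
    and rsmult_l_distr: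
      "\<lbrakk>x \<in> carrier M; y \<in> carrier M; a \<in> carrier R\<rbrakk> \<Longrightarrow>
       (x \<oplus>\<^bsub>M\<^esub> y) \<triangleleft>\<^bsub>M\<^esub> a = (x \<triangleleft>\<^bsub>M\<^esub> a) \<oplus>\<^bsub>M\<^esub> (y \<triangleleft>\<^bsub>M\<^esub> a)"
    and rsmult_r_distr:
      "\<lbrakk>x \<in> carrier M; a \<in> carrier R; b \<in> carrier R\<rbrakk> \<Longrightarrow>
       x \<triangleleft>\<^bsub>M\<^esub> (a \<oplus>\<^bsub>R\<^esub> b) = (x \<triangleleft>\<^bsub>M\<^esub> a) \<oplus>\<^bsub>M\<^esub> (x \<triangleleft>\<^bsub>M\<^esub> b)"
    and rsmult_assoc:
      "\<lbrakk>x \<in> carrier M; a \<in> carrier R; b \<in> carrier R\<rbrakk> \<Longrightarrow>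
       x \<triangleleft>\<^bsub>M\<^esub> (a \<otimes>\<^bsub>R\<^esub> b) = (x \<triangleleft>\<^bsub>M\<^esub> a) \<triangleleft>\<^bsub>M\<^esub> b"
    and rsmult_one [simp]:
      "x \<in> carrier M \<Longrightarrow> x \<triangleleft>\<^bsub>M\<^esub> \<one>\<^bsub>R\<^esub> = x"

definition regular_rmodule :: "('a, 'c) ring_scheme \<Rightarrow> ('a, 'a) rmodule"
  where "regular_rmodule T =
    \<lparr>carrier = carrier T, mult = (\<otimes>\<^bsub>T\<^esub>), one = \<one>\<^bsub>T\<^esub>, zero = \<zero>\<^bsub>T\<^esub>, add = (\<oplus>\<^bsub>T\<^esub>),
     rsmult = (\<otimes>\<^bsub>T\<^esub>)\<rparr>"

text \<open>
  The sets of polynomials \<open>R[x]\<close> and \<open>M[x]\<close> are the library's \<^term>\<open>up R\<close> and \<^term>\<open>up M\<close>: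
  a polynomial is its finitely supported sequence of coefficients. Below, \<open>m f\<close> is given by its
  coefficients, the one at \<open>x\<^sup>k\<close> being the sum of the \<open>m\<^sub>i a\<^sub>j\<close> with \<open>i + j = k\<close>.
\<close>

definition poly_rsmult ::
    "('a, 'b, 'd) rmodule_scheme \<Rightarrow> (nat \<Rightarrow> 'b) \<Rightarrow> (nat \<Rightarrow> 'a) \<Rightarrow> nat \<Rightarrow> 'b"
  where "poly_rsmult M m f = (\<lambda>k. \<Oplus>\<^bsub>M\<^esub>i \<in> {..k}. m i \<triangleleft>\<^bsub>M\<^esub> f (k - i))"

locale armendariz_module = right_module +
  assumes armendariz:
    "\<lbrakk>m \<in> up M; f \<in> up R; poly_rsmult M m f = (\<lambda>k. \<zero>\<^bsub>M\<^esub>)\<rbrakk> \<Longrightarrow> m i \<triangleleft>\<^bsub>M\<^esub> f j = \<zero>\<^bsub>M\<^esub>"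

definition armendariz_ring :: "('a, 'c) ring_scheme \<Rightarrow> bool"
  where "armendariz_ring T \<longleftrightarrow> armendariz_module T (regular_rmodule T)"

definition condition_C2 ::
    "('a, 'c) ring_scheme \<Rightarrow> ('a \<Rightarrow> 'a) \<Rightarrow> ('a, 'b, 'd) rmodule_scheme \<Rightarrow> bool"
  where "condition_C2 R \<sigma> M \<longleftrightarrow>
    (\<forall>m \<in> carrier M. \<forall>a \<in> carrier R.
       m \<triangleleft>\<^bsub>M\<^esub> (\<sigma> a \<otimes>\<^bsub>R\<^esub> a) = \<zero>\<^bsub>M\<^esub> \<longrightarrow> m \<triangleleft>\<^bsub>M\<^esub> \<sigma> a = \<zero>\<^bsub>M\<^esub>)"

definition nagata_extension ::
    "('a, 'c) ring_scheme \<Rightarrow> ('a \<Rightarrow> 'a) \<Rightarrow> ('a, 'b, 'd) rmodule_scheme \<Rightarrow> ('a \<times> 'b) ring"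
  where "nagata_extension R \<sigma> M =
    \<lparr>carrier = carrier R \<times> carrier M,
     mult = (\<lambda>(a, m) (b, n). (a \<otimes>\<^bsub>R\<^esub> b, (n \<triangleleft>\<^bsub>M\<^esub> \<sigma> a) \<oplus>\<^bsub>M\<^esub> (m \<triangleleft>\<^bsub>M\<^esub> b))),
     one = (\<one>\<^bsub>R\<^esub>, \<zero>\<^bsub>M\<^esub>),
     zero = (\<zero>\<^bsub>R\<^esub>, \<zero>\<^bsub>M\<^esub>),
     add = (\<lambda>(a, m) (b, n). (a \<oplus>\<^bsub>R\<^esub> b, m \<oplus>\<^bsub>M\<^esub> n))\<rparr>"

lemma right_module_regular:
  assumes "ring T"
  shows "right_module T (regular_rmodule T)"
proof -
  interpret T: ring T by fact
  have "abelian_group (regular_rmodule T)"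
  proof (rule abelian_groupI)
    fix x assume "x \<in> carrier (regular_rmodule T)"
    then show "\<exists>y \<in> carrier (regular_rmodule T).
        y \<oplus>\<^bsub>regular_rmodule T\<^esub> x = \<zero>\<^bsub>regular_rmodule T\<^esub>"
      by (auto simp: regular_rmodule_def intro: T.l_neg bexI[of _ "\<ominus>\<^bsub>T\<^esub> x"])
  qed (auto simp: regular_rmodule_def T.a_ac)
  then show ?thesis
    by (intro right_module.intro right_module_axioms.intro assms)
      (auto simp: regular_rmodule_def T.l_distr T.r_distr T.m_assoc)
qed

lemma (in right_module) rsmult_zero_left [simp]:
  assumes "a \<in> carrier R" shows "\<zero>\<^bsub>M\<^esub> \<triangleleft>\<^bsub>M\<^esub> a = \<zero>\<^bsub>M\<^esub>"
proof -
  have "\<zero>\<^bsub>M\<^esub> \<triangleleft>\<^bsub>M\<^esub> a \<oplus>\<^bsub>M\<^esub> \<zero>\<^bsub>M\<^esub> \<triangleleft>\<^bsub>M\<^esub> a = \<zero>\<^bsub>M\<^esub> \<triangleleft>\<^bsub>M\<^esub> a"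
    using rsmult_l_distr[of "\<zero>\<^bsub>M\<^esub>" "\<zero>\<^bsub>M\<^esub>" a] assms by simp
  then show ?thesis using assms by (metis M.add.l_cancel_one' M.zero_closed rsmult_closed)
qed

lemma ring_nagata_extension:
  assumes "cring R" "right_module R M" and \<sigma>: "\<sigma> \<in> ring_hom R R"
  shows "ring (nagata_extension R \<sigma> M)" (is "ring ?T")
proof -
  interpret R: cring R by fact
  interpret M: right_module R M by fact
  have [simp]: "\<And>a. a \<in> carrier R \<Longrightarrow> \<sigma> a \<in> carrier R"
    and [simp]: "\<sigma> \<one>\<^bsub>R\<^esub> = \<one>\<^bsub>R\<^esub>"
    and hom: "\<And>a b. \<lbrakk>a \<in> carrier R; b \<in> carrier R\<rbrakk> \<Longrightarrow> \<sigma> (a \<otimes>\<^bsub>R\<^esub> b) = \<sigma> a \<otimes>\<^bsub>R\<^esub> \<sigma> b"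
      "\<And>a b. \<lbrakk>a \<in> carrier R; b \<in> carrier R\<rbrakk> \<Longrightarrow> \<sigma> (a \<oplus>\<^bsub>R\<^esub> b) = \<sigma> a \<oplus>\<^bsub>R\<^esub> \<sigma> b"
    using \<sigma> by (auto simp: ring_hom_closed ring_hom_one ring_hom_mult ring_hom_add)
  have comm: "(x \<triangleleft>\<^bsub>M\<^esub> a) \<triangleleft>\<^bsub>M\<^esub> b = (x \<triangleleft>\<^bsub>M\<^esub> b) \<triangleleft>\<^bsub>M\<^esub> a"
    if "x \<in> carrier M" "a \<in> carrier R" "b \<in> carrier R" for x a b
    using that by (metis M.rsmult_assoc R.m_comm)
  have "abelian_group ?T"
  proof (rule abelian_groupI)
    fix x assume "x \<in> carrier ?T"
    then show "\<exists>y \<in> carrier ?T. y \<oplus>\<^bsub>?T\<^esub> x = \<zero>\<^bsub>?T\<^esub>"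
      by (cases x)
        (auto simp: nagata_extension_def R.l_neg M.M.l_neg
          intro!: bexI[of _ "(\<ominus>\<^bsub>R\<^esub> fst x, \<ominus>\<^bsub>M\<^esub> snd x)"])
  qed (auto simp: nagata_extension_def R.a_ac M.M.a_ac)
  moreover have "monoid ?T"
    by (rule monoidI)
      (auto simp: nagata_extension_def hom comm R.m_assoc M.rsmult_assoc M.rsmult_l_distr M.M.a_ac)
  ultimately show ?thesis
    by (rule ringI)
      (auto simp: nagata_extension_def hom R.l_distr R.r_distr M.rsmult_l_distr M.rsmult_r_distr
        M.M.a_ac)
qed

end

theory Submission
  imports Defs
begin

text \<open>
  Write the coefficients of two polynomials over the extension as \<open>(f\<^sub>i, m\<^sub>i)\<close> and \<open>(g\<^sub>j, n\<^sub>j)\<close>. Their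
  product vanishes iff \<open>f g = 0\<close> and \<open>n \<sigma>(f) + m g = 0\<close>. If \<open>R\<close> is Armendariz, then all \<open>f\<^sub>l g\<^sub>j\<close> are
  zero, so multiplying the second equation by the single coefficient \<open>f\<^sub>l\<close> leaves \<open>n (\<sigma>(f) f\<^sub>l) = 0\<close>.
  If \<open>M\<close> is Armendariz, it follows that \<open>n\<^sub>j \<sigma>(f\<^sub>i) f\<^sub>l = 0\<close>; for \<open>l = i\<close> the condition on \<open>\<sigma>\<close> gives
  \<open>n\<^sub>j \<sigma>(f\<^sub>i) = 0\<close>. Hence \<open>m g = 0\<close> and \<open>m\<^sub>i g\<^sub>j = 0\<close>. Conversely, \<open>m f\<close> is the product of the
  polynomials with coefficients \<open>(0, m\<^sub>i)\<close> and \<open>(f\<^sub>j, 0)\<close>.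
\<close>

text \<open>Induction on \<open>A\<close>; for infinite \<open>A\<close> both sums are zero by
  convention, so \<open>zero\<close> settles that case as well. Later \<open>h\<close> is the action
  of a ring element on \<open>M\<close>, or one of the two projections of the extension.\<close>

lemma finsum_additive:
  assumes "abelian_monoid G" "abelian_monoid H"
    and closed: "\<And>x. x \<in> carrier G \<Longrightarrow> h x \<in> carrier H"
    and zero: "h \<zero>\<^bsub>G\<^esub> = \<zero>\<^bsub>H\<^esub>"
    and add: "\<And>x y. \<lbrakk>x \<in> carrier G; y \<in> carrier G\<rbrakk> \<Longrightarrow> h (x \<oplus>\<^bsub>G\<^esub> y) = h x \<oplus>\<^bsub>H\<^esub> h y"
    and "f \<in> A \<rightarrow> carrier G"
  shows "h (finsum G f A) = (\<Oplus>\<^bsub>H\<^esub>i \<in> A. h (f i))"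
proof -
  interpret G: abelian_monoid G by fact
  interpret H: abelian_monoid H by fact
  show ?thesis
    using \<open>f \<in> A \<rightarrow> carrier G\<close>
    by (induct A rule: infinite_finite_induct) (auto simp: Pi_def closed zero add)
qed

lemma up_map:
  assumes "p \<in> up G" "\<And>x. x \<in> carrier G \<Longrightarrow> h x \<in> carrier H" "h \<zero>\<^bsub>G\<^esub> = \<zero>\<^bsub>H\<^esub>"
  shows "(\<lambda>i. h (p i)) \<in> up H"
proof -
  obtain n where "bound \<zero>\<^bsub>G\<^esub> n p" using assms(1) by (auto simp: up_def)
  then have "bound \<zero>\<^bsub>H\<^esub> n (\<lambda>i. h (p i))" using assms(3) by (auto simp: bound_def)
  with assms show ?thesis by (auto simp: up_def)
qed

text \<open>The Armendariz property of a ring speaks of its regular module; this equation and the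
  next carry polynomials and zero back to the ring.\<close>

lemma up_regular: "up (regular_rmodule T) = up T"
  by (simp add: up_def regular_rmodule_def)

lemma zero_regular: "\<zero>\<^bsub>regular_rmodule T\<^esub> = \<zero>\<^bsub>T\<^esub>"
  by (simp add: regular_rmodule_def)

lemma (in right_module) rsmult_zero_right [simp]:
  assumes "x \<in> carrier M" shows "x \<triangleleft>\<^bsub>M\<^esub> \<zero> = \<zero>\<^bsub>M\<^esub>"
proof -
  have "x \<triangleleft>\<^bsub>M\<^esub> \<zero> \<oplus>\<^bsub>M\<^esub> x \<triangleleft>\<^bsub>M\<^esub> \<zero> = x \<triangleleft>\<^bsub>M\<^esub> \<zero>"
    using rsmult_r_distr[of x \<zero> \<zero>] assms by simp
  then show ?thesis using assms by (metis M.add.l_cancel_one' R.zero_closed rsmult_closed)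
qed

lemma (in right_module) poly_rsmult_closed:
  assumes "m \<in> up M" "f \<in> up R"
  shows "poly_rsmult M m f k \<in> carrier M"
  unfolding poly_rsmult_def
  by (rule M.finsum_closed) (use assms in \<open>auto intro!: rsmult_closed simp: up_def\<close>)

lemma (in right_module) poly_rsmult_eq_zero:
  assumes "\<And>i j. m i \<triangleleft>\<^bsub>M\<^esub> f j = \<zero>\<^bsub>M\<^esub>"
  shows "poly_rsmult M m f k = \<zero>\<^bsub>M\<^esub>"
  by (simp add: poly_rsmult_def assms)

text \<open>By associativity, a scalar acting on a coefficient of the product can be absorbed into
  the right factor.\<close>

lemma (in right_module) poly_rsmult_scale:
  assumes "m \<in> up M" "f \<in> up R" "a \<in> carrier R"
  shows "poly_rsmult M m f k \<triangleleft>\<^bsub>M\<^esub> a = poly_rsmult M m (\<lambda>i. f i \<otimes> a) k"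
proof -
  have *: "m i \<in> carrier M" "f i \<in> carrier R" for i using assms by (auto simp: up_def)
  have "poly_rsmult M m f k \<triangleleft>\<^bsub>M\<^esub> a = (\<Oplus>\<^bsub>M\<^esub>i \<in> {..k}. (m i \<triangleleft>\<^bsub>M\<^esub> f (k - i)) \<triangleleft>\<^bsub>M\<^esub> a)"
    unfolding poly_rsmult_def
    by (rule finsum_additive[where h = "\<lambda>x. x \<triangleleft>\<^bsub>M\<^esub> a"])
      (use assms(3) * in \<open>auto simp: rsmult_l_distr M.abelian_monoid_axioms\<close>)
  then show ?thesis using * assms(3) by (simp add: poly_rsmult_def rsmult_assoc)
qed

text \<open>Substitution of \<open>k - i\<close> for \<open>i\<close>. Multiplication in the
  extension takes the module factor of its twisted term from the right operand, so that sum arises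
  in this order.\<close>

lemma (in right_module) poly_rsmult_reversed:
  assumes "m \<in> up M" "f \<in> up R"
  shows "poly_rsmult M m f k = (\<Oplus>\<^bsub>M\<^esub>i \<in> {..k}. m (k - i) \<triangleleft>\<^bsub>M\<^esub> f i)"
proof -
  have *: "m i \<in> carrier M" "f i \<in> carrier R" for i using assms by (auto simp: up_def)
  have image: "(\<lambda>i. k - i) ` {..k} = {..k}"
    \<comment> \<open>The preimage of \<open>i\<close> is \<open>k - i\<close>, as
      \<open>k - (k - i) = i\<close> for \<open>i \<le> k\<close>.\<close>
    by (auto simp: image_iff) (metis atMost_iff diff_diff_cancel diff_le_self)
  have "(\<Oplus>\<^bsub>M\<^esub>i \<in> (\<lambda>i. k - i) ` {..k}. m (k - i) \<triangleleft>\<^bsub>M\<^esub> f i) =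
      (\<Oplus>\<^bsub>M\<^esub>i \<in> {..k}. m (k - (k - i)) \<triangleleft>\<^bsub>M\<^esub> f (k - i))"
    by (rule M.finsum_reindex) (use * in \<open>auto simp: inj_on_def\<close>)
  also have "\<dots> = poly_rsmult M m f k"
    unfolding poly_rsmult_def by (rule M.finsum_cong') (use * in auto)
  finally show ?thesis by (simp add: image)
qed

locale nagata = R?: cring R + right_module R M
  for R :: "('a, 'c) ring_scheme" (structure) and M :: "('a, 'b, 'd) rmodule_scheme" (structure) +
  fixes \<sigma> :: "'a \<Rightarrow> 'a"
  assumes hom: "\<sigma> \<in> ring_hom R R"
begin

abbreviation "T \<equiv> nagata_extension R \<sigma> M"

lemma hom_closed [simp]: "a \<in> carrier R \<Longrightarrow> \<sigma> a \<in> carrier R"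
  by (rule ring_hom_closed[OF hom])

lemma hom_zero [simp]: "\<sigma> \<zero> = \<zero>"
  by (rule ring_hom_zero[OF hom R.ring_axioms R.ring_axioms])

text \<open>Commutativity of \<open>R\<close> enters through \<open>ring_nagata_extension\<close>,
  where it makes the multiplication associative.\<close>

lemma right_module_T: "right_module T (regular_rmodule T)"
  by (intro right_module_regular ring_nagata_extension hom R.cring_axioms right_module_axioms)

lemma up_T_iff: "p \<in> up T \<longleftrightarrow> (\<lambda>i. fst (p i)) \<in> up R \<and> (\<lambda>i. snd (p i)) \<in> up M"
proof
  assume p: "p \<in> up T"
  show "(\<lambda>i. fst (p i)) \<in> up R \<and> (\<lambda>i. snd (p i)) \<in> up M"
    by (intro conjI up_map[OF p]) (auto simp: nagata_extension_def)
next
  assume p: "(\<lambda>i. fst (p i)) \<in> up R \<and> (\<lambda>i. snd (p i)) \<in> up M"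
  then obtain n l where "bound \<zero> n (\<lambda>i. fst (p i))" "bound \<zero>\<^bsub>M\<^esub> l (\<lambda>i. snd (p i))"
    by (auto simp: up_def)
  \<comment> \<open>Beyond the larger of the two bounds both components vanish.\<close>
  then have "bound \<zero>\<^bsub>T\<^esub> (max n l) p"
    by (auto simp: bound_def nagata_extension_def prod_eq_iff)
  moreover have "p i \<in> carrier T" for i
    using p by (auto simp: up_def Pi_def nagata_extension_def mem_Times_iff)
  ultimately show "p \<in> up T" by (auto simp: up_def)
qed

text \<open>Both projections are additive, so each coefficient can be computed componentwise. In the
  twisted term \<open>q\<close> supplies the module factor and \<open>p\<close> the scalar.\<close>

lemma poly_rsmult_T:
  assumes p: "p \<in> up T" and q: "q \<in> up T"
  shows "poly_rsmult (regular_rmodule T) p q k =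
    (poly_rsmult (regular_rmodule R) (\<lambda>i. fst (p i)) (\<lambda>i. fst (q i)) k,
     poly_rsmult M (\<lambda>i. snd (q i)) (\<lambda>i. \<sigma> (fst (p i))) k \<oplus>\<^bsub>M\<^esub>
     poly_rsmult M (\<lambda>i. snd (p i)) (\<lambda>i. fst (q i)) k)"
proof (rule prod_eqI)
  interpret T: right_module T "regular_rmodule T" by (rule right_module_T)
  interpret RR: right_module R "regular_rmodule R"
    by (rule right_module_regular[OF R.ring_axioms])
  have c: "p i \<in> carrier T" "q i \<in> carrier T" for i using p q by (auto simp: up_def)
  then have cR: "fst (p i) \<in> carrier R" "fst (q i) \<in> carrier R"
    and cM: "snd (p i) \<in> carrier M" "snd (q i) \<in> carrier M" for i
    by (auto simp: nagata_extension_def mem_Times_iff)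
  have prod: "(\<lambda>i. p i \<triangleleft>\<^bsub>regular_rmodule T\<^esub> q (k - i)) \<in> {..k} \<rightarrow> carrier (regular_rmodule T)"
    using c by (auto simp: regular_rmodule_def)
  have "fst (poly_rsmult (regular_rmodule T) p q k) =
      (\<Oplus>\<^bsub>regular_rmodule R\<^esub>i \<in> {..k}. fst (p i \<triangleleft>\<^bsub>regular_rmodule T\<^esub> q (k - i)))"
    unfolding poly_rsmult_def
    by (rule finsum_additive[where h = fst, OF T.M.abelian_monoid_axioms
          RR.M.abelian_monoid_axioms _ _ _ prod])
      (auto simp: regular_rmodule_def nagata_extension_def)
  then show "fst (poly_rsmult (regular_rmodule T) p q k) =
    fst (poly_rsmult (regular_rmodule R) (\<lambda>i. fst (p i)) (\<lambda>i. fst (q i)) k,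
     poly_rsmult M (\<lambda>i. snd (q i)) (\<lambda>i. \<sigma> (fst (p i))) k \<oplus>\<^bsub>M\<^esub>
     poly_rsmult M (\<lambda>i. snd (p i)) (\<lambda>i. fst (q i)) k)"
    by (simp add: poly_rsmult_def regular_rmodule_def nagata_extension_def case_prod_beta)
  have up: "(\<lambda>i. snd (q i)) \<in> up M" "(\<lambda>i. \<sigma> (fst (p i))) \<in> up R"
    using p q by (auto simp: up_T_iff intro!: up_map[where h = \<sigma>])
  have "snd (poly_rsmult (regular_rmodule T) p q k) =
      (\<Oplus>\<^bsub>M\<^esub>i \<in> {..k}. snd (p i \<triangleleft>\<^bsub>regular_rmodule T\<^esub> q (k - i)))"
    unfolding poly_rsmult_def
    by (rule finsum_additive[where h = snd, OF T.M.abelian_monoid_axioms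
          M.abelian_monoid_axioms _ _ _ prod])
      (auto simp: regular_rmodule_def nagata_extension_def)
  also have "\<dots> = (\<Oplus>\<^bsub>M\<^esub>i \<in> {..k}.
      snd (q (k - i)) \<triangleleft>\<^bsub>M\<^esub> \<sigma> (fst (p i)) \<oplus>\<^bsub>M\<^esub> snd (p i) \<triangleleft>\<^bsub>M\<^esub> fst (q (k - i)))"
    by (simp add: regular_rmodule_def nagata_extension_def case_prod_beta)
  also have "\<dots> = (\<Oplus>\<^bsub>M\<^esub>i \<in> {..k}. snd (q (k - i)) \<triangleleft>\<^bsub>M\<^esub> \<sigma> (fst (p i))) \<oplus>\<^bsub>M\<^esub>
      (\<Oplus>\<^bsub>M\<^esub>i \<in> {..k}. snd (p i) \<triangleleft>\<^bsub>M\<^esub> fst (q (k - i)))"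
    by (rule M.finsum_addf) (use cR cM in auto)
  finally show "snd (poly_rsmult (regular_rmodule T) p q k) =
    snd (poly_rsmult (regular_rmodule R) (\<lambda>i. fst (p i)) (\<lambda>i. fst (q i)) k,
     poly_rsmult M (\<lambda>i. snd (q i)) (\<lambda>i. \<sigma> (fst (p i))) k \<oplus>\<^bsub>M\<^esub>
     poly_rsmult M (\<lambda>i. snd (p i)) (\<lambda>i. fst (q i)) k)"
    \<comment> \<open>Only the twisted sum is in reversed order; the other one already has the
      defining form.\<close>
    by (simp add: poly_rsmult_reversed[OF up]) (simp add: poly_rsmult_def)
qed

lemma armendariz_module_if_nagata:
  assumes "armendariz_ring T"
  shows "armendariz_module R M"
proof
  fix m f i j
  assume m: "m \<in> up M" and f: "f \<in> up R" and mf: "poly_rsmult M m f = (\<lambda>k. \<zero>\<^bsub>M\<^esub>)"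
  interpret T: armendariz_module T "regular_rmodule T"
    using assms by (simp add: armendariz_ring_def)
  interpret RR: right_module R "regular_rmodule R"
    by (rule right_module_regular[OF R.ring_axioms])
  define p where "p = (\<lambda>i. (\<zero>, m i))"
  define q where "q = (\<lambda>j. (f j, \<zero>\<^bsub>M\<^esub>))"
  have c: "m i \<in> carrier M" "f i \<in> carrier R" for i using m f by (auto simp: up_def)
  have up: "p \<in> up T" "q \<in> up T" using m f by (auto simp: up_T_iff p_def q_def)
  \<comment> \<open>Apart from \<open>m f\<close>, the product formula has two parts, and both
    vanish: the ring component has left factor zero, and in the twisted term the module factor is
    zero and the scalar is \<open>\<sigma> \<zero> = \<zero>\<close>.\<close>
  have "poly_rsmult (regular_rmodule R) (\<lambda>i. \<zero>) f k = \<zero>" for k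
    using RR.poly_rsmult_eq_zero[of "\<lambda>i. \<zero>" f k] c by (simp add: regular_rmodule_def)
  moreover have "poly_rsmult M (\<lambda>i. \<zero>\<^bsub>M\<^esub>) (\<lambda>i. \<zero>) k = \<zero>\<^bsub>M\<^esub>" for k
    by (rule poly_rsmult_eq_zero) simp
  ultimately have "poly_rsmult (regular_rmodule T) p q = (\<lambda>k. \<zero>\<^bsub>regular_rmodule T\<^esub>)"
    by (simp add: fun_eq_iff poly_rsmult_T[OF up])
      (simp add: p_def q_def mf regular_rmodule_def nagata_extension_def)
  from T.armendariz[unfolded up_regular, OF up this] show "m i \<triangleleft>\<^bsub>M\<^esub> f j = \<zero>\<^bsub>M\<^esub>"
    using c by (simp add: p_def q_def regular_rmodule_def nagata_extension_def)
qed

lemma nagata_if_armendariz_module: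
  assumes R: "armendariz_ring R" and C2: "condition_C2 R \<sigma> M" and M: "armendariz_module R M"
  shows "armendariz_ring T"
  unfolding armendariz_ring_def
proof (intro armendariz_module.intro armendariz_module_axioms.intro right_module_T,
    unfold up_regular)
  fix p q i j
  assume p: "p \<in> up T" and q: "q \<in> up T"
    and pq: "poly_rsmult (regular_rmodule T) p q = (\<lambda>k. \<zero>\<^bsub>regular_rmodule T\<^esub>)"
  interpret RR: armendariz_module R "regular_rmodule R"
    using R by (simp add: armendariz_ring_def)
  interpret AM: armendariz_module R M by fact
  define f m g n where "f = (\<lambda>i. fst (p i))" and "m = (\<lambda>i. snd (p i))"
    and "g = (\<lambda>i. fst (q i))" and "n = (\<lambda>i. snd (q i))"
  have up: "f \<in> up R" "m \<in> up M" "g \<in> up R" "n \<in> up M"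
    using p q by (auto simp: up_T_iff f_def m_def g_def n_def)
  then have c: "f i \<in> carrier R" "m i \<in> carrier M" "g i \<in> carrier R" "n i \<in> carrier M" for i
    by (auto simp: up_def)
  have up_\<sigma>: "(\<lambda>i. \<sigma> (f i)) \<in> up R" by (rule up_map[OF up(1)]) auto
  have eqs: "poly_rsmult (regular_rmodule R) f g k = \<zero>"
    "poly_rsmult M n (\<lambda>i. \<sigma> (f i)) k \<oplus>\<^bsub>M\<^esub> poly_rsmult M m g k = \<zero>\<^bsub>M\<^esub>" for k
    using fun_cong[OF pq, of k] unfolding poly_rsmult_T[OF p q] f_def m_def g_def n_def
    by (simp_all add: zero_regular nagata_extension_def)
  have fg: "f i \<otimes> g j = \<zero>" for i j
    using RR.armendariz[of f g i j] up eqs(1)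
    by (simp add: fun_eq_iff regular_rmodule_def up_regular up_def)
  \<comment> \<open>The index \<open>l\<close> stays fixed, so that multiplying by
    \<open>f l\<close> gives a polynomial over \<open>R\<close> again and the Armendariz property of
    \<open>M\<close> applies to it.\<close>
  have n\<sigma>ff: "n j \<triangleleft>\<^bsub>M\<^esub> (\<sigma> (f i) \<otimes> f l) = \<zero>\<^bsub>M\<^esub>" for i j l
  proof (rule AM.armendariz[OF up(4), where f = "\<lambda>i. \<sigma> (f i) \<otimes> f l"])
    show up_\<sigma>f: "(\<lambda>i. \<sigma> (f i) \<otimes> f l) \<in> up R"
      by (rule up_map[OF up(1), where h = "\<lambda>a. \<sigma> a \<otimes> f l"]) (use c in auto)
    show "poly_rsmult M n (\<lambda>i. \<sigma> (f i) \<otimes> f l) = (\<lambda>k. \<zero>\<^bsub>M\<^esub>)"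
    proof
      fix k
      \<comment> \<open>Commutativity turns \<open>g j \<otimes> f l\<close> into
        \<open>f l \<otimes> g j\<close>, which \<open>fg\<close> makes zero.\<close>
      have "poly_rsmult M m (\<lambda>i. g i \<otimes> f l) k = \<zero>\<^bsub>M\<^esub>"
        by (rule poly_rsmult_eq_zero) (use c fg in \<open>simp add: R.m_comm[of "g _"]\<close>)
      \<comment> \<open>The vanishing sum is added back, to reach the second equation of
        \<open>eqs\<close> multiplied by \<open>f l\<close>.\<close>
      then have "poly_rsmult M n (\<lambda>i. \<sigma> (f i) \<otimes> f l) k =
          (poly_rsmult M n (\<lambda>i. \<sigma> (f i)) k \<oplus>\<^bsub>M\<^esub> poly_rsmult M m g k) \<triangleleft>\<^bsub>M\<^esub> f l"
        using c up up_\<sigma> poly_rsmult_closed[OF up(4) up_\<sigma>f, of k]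
        by (simp add: rsmult_l_distr poly_rsmult_closed poly_rsmult_scale flip: rsmult_assoc)
      then show "poly_rsmult M n (\<lambda>i. \<sigma> (f i) \<otimes> f l) k = \<zero>\<^bsub>M\<^esub>" using c by (simp add: eqs)
    qed
  qed
  have n\<sigma>f: "n j \<triangleleft>\<^bsub>M\<^esub> \<sigma> (f i) = \<zero>\<^bsub>M\<^esub>" for i j
    using C2 c n\<sigma>ff[of j i i] by (auto simp: condition_C2_def)
  \<comment> \<open>With the twisted term gone, the second equation reduces to
    \<open>m g = 0\<close>.\<close>
  have "poly_rsmult M m g k = \<zero>\<^bsub>M\<^esub>" for k
    using eqs(2)[of k] poly_rsmult_closed[OF up(2,3)] by (simp add: poly_rsmult_eq_zero n\<sigma>f)
  then have "m i \<triangleleft>\<^bsub>M\<^esub> g j = \<zero>\<^bsub>M\<^esub>" by (intro AM.armendariz up ext)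
  with fg n\<sigma>f show "p i \<triangleleft>\<^bsub>regular_rmodule T\<^esub> q j = \<zero>\<^bsub>regular_rmodule T\<^esub>"
    by (simp add: regular_rmodule_def nagata_extension_def case_prod_beta f_def m_def g_def n_def)
qed

end

theorem theorem3p8:
  fixes R :: "('a, 'c) ring_scheme"
    and M :: "('a, 'b, 'd) rmodule_scheme"
    and \<sigma> :: "'a \<Rightarrow> 'a"
  assumes "cring R"
    and "armendariz_ring R"
    and "\<sigma> \<in> ring_hom R R"
    and "right_module R M"
    and "condition_C2 R \<sigma> M"
  shows "armendariz_module R M \<longleftrightarrow> armendariz_ring (nagata_extension R \<sigma> M)"
proof -
  interpret nagata R M \<sigma>
    by (intro nagata.intro nagata_axioms.intro assms)
  show ?thesis
    using armendariz_module_if_nagata nagata_if_armendariz_module assms by blast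
qed

end
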